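(* Let $F_\alpha$ be the $\alpha$-Farey map of a partition $\alpha$ (with $\sum_n t_n=\infty$), with associated measure $\mu_\alpha$, transfer operator $\widehat F_\alpha$ and wandering rate $(w_n)_{n\in\mathbb N}$, and assume that $\lim_{n\to\infty} w_n/w_{n+1}=1$. Let $\delta\in(0,1]$ and $\Gamma_\delta:=(\Gamma(1+\delta)\Gamma(2-\delta))^{-1}$, where $\Gamma$ is the Gamma function. If $v\in\mathcal L^1_{\mu_\alpha}([0,1])$ satisfies \[ \lim_{n\to+\infty} w_n\,\widehat F_\alpha^{\,n}(v)=\Gamma_\delta\int v\,\mathrm d\mu_\alpha \] uniformly on $\overline A_1$, then the same convergence holds uniformly on any compact subset of $(0,1]$. The same statement holds when uniform convergence is replaced (in both hypothesis and conclusion) by almost everywhere uniform convergence.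
   Context: Setting. $\alpha=\{A_n:n\in\mathbb N\}$ is a countably infinite partition of $(0,1)$ into non-empty left-closed, right-open intervals, ordered from right to left starting with $A_1$, and accumulating only at $0$. Put $a_n:=\lambda(A_n)$ ($\lambda$ = Lebesgue measure), $t_n:=\sum_{k\ge n}a_k$, so $t_1=1$ and $A_n=[t_{n+1},t_n)$; it is assumed that $\sum_n t_n=\infty$. Put $\overline A_1:=A_1\cup\{1\}$. The $\alpha$-Farey map $F_\alpha:[0,1]\to[0,1]$ is $F_\alpha(x)=(1-x)/a_1$ for $x\in\overline A_1$, $F_\alpha(x)=a_{n-1}(x-t_{n+1})/a_n+t_n$ for $x\in A_n$, $n\ge2$, and $F_\alpha(0)=0$. The $F_\alpha$-invariant measure $\mu_\alpha$ has density $h_\alpha=\mathrm d\mu_\alpha/\mathrm d\lambda=\sum_{n}\frac{t_n}{a_n}\mathbf 1_{A_n}$. $\mathcal L^1_{\mu_\alpha}([0,1])$ is the class of measurable functions $f$ (not equivalence classes) on $[0,1]$ with $\int|f|\,\mathrm d\mu_\alpha<\infty$. Let $F_{\alpha,0}:=(F_\alpha|_{[0,t_2]})^{-1}$ and $F_{\alpha,1}:=(F_\alpha|_{[t_2,1]})^{-1}$ be the inverse branches, both defined on $[0,1]$. The $\alpha$-Farey transfer operator acts pointwise on $\mathcal L^1_{\mu_\alpha}([0,1])$ by \[ \widehat F_\alpha(v)(x)=\frac{t_{n+1}}{t_n}\,v(F_{\alpha,0}(x))+\Bigl(1-\frac{t_{n+1}}{t_n}\Bigr)v(F_{\alpha,1}(x))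 \] for $x\in A_n$, $n\in\mathbb N$ (the formula with $n=1$ being used also at $x=1$), and $\widehat F_\alpha(v)(0)=0$. The wandering rate is $w_n:=\mu_\alpha(\bigcup_{k=1}^nA_k)=\sum_{k=1}^nt_k$. Almost everywhere uniform convergence on a set means uniform convergence on that set after removal of a null set. *)

theory Defs
  imports "HOL-Analysis.Analysis"
begin

text \<open>
  A partition is given by the sequence of its atoms \<open>A 1, A 2, \<dots>\<close>; the value \<open>A 0\<close> is
  irrelevant and never used.
\<close>

definition interval_partition :: "(nat \<Rightarrow> real set) \<Rightarrow> bool" where
  "interval_partition A \<longleftrightarrow>
     (\<forall>n\<ge>1. \<exists>l r. l < r \<and> A n = {l..<r}) \<and>
     disjoint_family_on A {1..} \<and>
     (\<Union>n\<in>{1..}. A n) = {0<..<1} \<and>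
     (\<forall>m\<ge>1. \<forall>n>m. \<forall>x\<in>A m. \<forall>y\<in>A n. y < x) \<and>
     (\<forall>\<epsilon>>0. finite {n. n \<ge> 1 \<and> \<not> A n \<subseteq> {0<..<\<epsilon>}})"

definition atom_length :: "(nat \<Rightarrow> real set) \<Rightarrow> nat \<Rightarrow> real" where
  "atom_length A n = measure lebesgue (A n)"

definition atom_tail :: "(nat \<Rightarrow> real set) \<Rightarrow> nat \<Rightarrow> real" where
  "atom_tail A n = (\<Sum>k. atom_length A (n + k))"

definition first_atom :: "(nat \<Rightarrow> real set) \<Rightarrow> real set" where
  "first_atom A = insert 1 (A 1)"

definition atom_index :: "(nat \<Rightarrow> real set) \<Rightarrow> real \<Rightarrow> nat" where
  "atom_index A x = (THE n. n \<ge> 1 \<and> x \<in> A n)"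

text \<open>
  The maps and functions below live on \<open>[0,1]\<close>; as total functions on the reals they get
  the value \<open>0\<close> outside.
\<close>

definition farey_map :: "(nat \<Rightarrow> real set) \<Rightarrow> real \<Rightarrow> real" where
  "farey_map A x =
     (if x \<in> first_atom A then (1 - x) / atom_length A 1
      else if 0 < x \<and> x < 1 then
        (let n = atom_index A x in
           atom_length A (n - 1) * (x - atom_tail A (n + 1)) / atom_length A n + atom_tail A n)
      else 0)"

definition farey_density :: "(nat \<Rightarrow> real set) \<Rightarrow> real \<Rightarrow> real" where
  "farey_density A x =
     (\<Sum>n. atom_tail A (Suc n) / atom_length A (Suc n) * indicator (A (Suc n)) x)"

definition farey_measure :: "(nat \<Rightarrow> real set) \<Rightarrow> real measure" where
  "farey_measure A = density (lebesgue_on {0..1}) (\<lambda>x. ennreal (farey_density A x))"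

definition farey_branch0 :: "(nat \<Rightarrow> real set) \<Rightarrow> real \<Rightarrow> real" where
  "farey_branch0 A = the_inv_into {0..atom_tail A 2} (farey_map A)"

definition farey_branch1 :: "(nat \<Rightarrow> real set) \<Rightarrow> real \<Rightarrow> real" where
  "farey_branch1 A = the_inv_into {atom_tail A 2..1} (farey_map A)"

definition farey_transfer :: "(nat \<Rightarrow> real set) \<Rightarrow> (real \<Rightarrow> real) \<Rightarrow> real \<Rightarrow> real" where
  "farey_transfer A v x =
     (if 0 < x \<and> x \<le> 1 then
        (let n = (if x = 1 then 1 else atom_index A x);
             p = atom_tail A (n + 1) / atom_tail A n
         in p * v (farey_branch0 A x) + (1 - p) * v (farey_branch1 A x))
      else 0)"

definition wandering_rate :: "(nat \<Rightarrow> real set) \<Rightarrow> nat \<Rightarrow> real" where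
  "wandering_rate A n = measure (farey_measure A) (\<Union>k\<in>{1..n}. A k)"

definition Gamma_const :: "real \<Rightarrow> real" where
  "Gamma_const \<delta> = inverse (Gamma (1 + \<delta>) * Gamma (2 - \<delta>))"

text \<open>
  Null sets are taken with respect to Lebesgue measure. On \<open>[0,1]\<close> these are also the null
  sets of \<open>farey_measure A\<close>, whose density is positive on \<open>(0,1)\<close>.
\<close>

definition ae_uniform_limit ::
  "real set \<Rightarrow> (nat \<Rightarrow> real \<Rightarrow> real) \<Rightarrow> (real \<Rightarrow> real) \<Rightarrow> bool" where
  "ae_uniform_limit S f l \<longleftrightarrow>
     (\<exists>N \<in> null_sets lebesgue. uniform_limit (S - N) f l sequentially)"

end

theory Submission
  imports Defs
begin

text \<open>
  If \<open>y\<close> lies in atom \<open>n + 1\<close> and \<open>x\<close> is its image in atom \<open>n\<close>, then evaluating the transfer operator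
  at \<open>x\<close> expresses the value of the \<open>m\<close>-th iterate at \<open>y\<close> by that of the \<open>(m+1)\<close>-st iterate at \<open>x\<close>
  and that of the \<open>m\<close>-th iterate at the other preimage of \<open>x\<close>, which lies in the closed first atom.
  As \<open>w\<^sub>m / w\<^sub>m\<^sub>+\<^sub>1\<close> tends to \<open>1\<close>, convergence passes from atom \<open>n\<close> to atom \<open>n + 1\<close>, and a compact
  subset of \<open>(0,1]\<close> meets only finitely many atoms. The exceptional null sets are pulled back by
  affine maps.
\<close>

section \<open>Tools for uniform limits and null sets\<close>

lemma uniform_limit_mult_LIMSEQ:
  fixes r :: "nat \<Rightarrow> real" and f :: "nat \<Rightarrow> 'a \<Rightarrow> real"
  assumes "r \<longlonglongrightarrow> L" and "uniform_limit S f (\<lambda>_. c) sequentially"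
  shows "uniform_limit S (\<lambda>m x. r m * f m x) (\<lambda>_. L * c) sequentially"
proof (rule uniform_lim_mult)
  show "uniform_limit S (\<lambda>m x. r m) (\<lambda>_. L) sequentially"
    using assms(1) by (simp add: uniform_limit_iff tendsto_iff eventually_mono)
qed (use assms(2) in \<open>auto simp: image_constant_conv\<close>)

text \<open>The preimage is the image under the inverse affine map, and differentiable maps of the
  line send negligible sets to negligible sets.\<close>

lemma null_sets_affine_vimage:
  fixes c d :: real
  assumes "N \<in> null_sets lebesgue" and "c \<noteq> 0"
  shows "(\<lambda>x. c * x + d) -` N \<in> null_sets lebesgue"
proof -
  have "(\<lambda>x. c * x + d) -` N = (\<lambda>x. (x - d) / c) ` N"
    using assms(2) by (force simp: image_iff field_simps)
  moreover have "negligible ((\<lambda>x. (x - d) / c) ` N)"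
    using assms
    by (intro negligible_differentiable_image_negligible)
       (auto simp: negligible_iff_null_sets differentiable_on_def intro!: derivative_intros)
  ultimately show ?thesis
    by (simp add: negligible_iff_null_sets)
qed

section \<open>Geometry of the partition\<close>

locale farey_partition =
  fixes A :: "nat \<Rightarrow> real set"
  assumes partition: "interval_partition A"
begin

abbreviation "a \<equiv> atom_length A"
abbreviation "t \<equiv> atom_tail A"

lemma atom_subset: "n \<ge> 1 \<Longrightarrow> A n \<subseteq> {0<..<1}"
  using partition unfolding interval_partition_def by auto

lemma atom_exists:
  assumes "0 < x" "x < 1"
  obtains n where "n \<ge> 1" "x \<in> A n"
proof -
  have "x \<in> (\<Union>n\<in>{1..}. A n)"
    using partition assms unfolding interval_partition_def by auto
  then show thesis
    using that by auto
qed

text \<open>The atoms are only given as ordered intervals covering \<open>(0,1)\<close>. They leave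
  no gaps because an endpoint inside \<open>(0,1)\<close> belongs to some atom, and the ordering
  determines which one.\<close>

lemma atoms_adjacent:
  obtains r :: "nat \<Rightarrow> real"
  where "r 1 = 1" and "\<And>n. n \<ge> 1 \<Longrightarrow> A n = {r (Suc n)..<r n}"
    and "\<And>n. n \<ge> 1 \<Longrightarrow> r (Suc n) < r n" and "r \<longlonglongrightarrow> 0"
proof -
  obtain l r where lr: "\<And>n. n \<ge> 1 \<Longrightarrow> l n < r n \<and> A n = {l n..<r n}"
    using partition unfolding interval_partition_def by metis
  have ord: "\<And>m n x y. m \<ge> 1 \<Longrightarrow> n > m \<Longrightarrow> x \<in> A m \<Longrightarrow> y \<in> A n \<Longrightarrow> y < x"
    and acc: "\<And>e. e > 0 \<Longrightarrow> finite {n. n \<ge> 1 \<and> \<not> A n \<subseteq> {0<..<e}}"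
    using partition unfolding interval_partition_def by auto
  have lin: "l n \<in> A n" if "n \<ge> 1" for n
    using lr[OF that] by auto
  have l01: "0 < l n" "l n < 1" if "n \<ge> 1" for n
    using atom_subset[OF that] lin[OF that] by auto
  have r1: "r n \<le> 1" if n: "n \<ge> 1" for n
  proof (rule ccontr)
    assume "\<not> r n \<le> 1"
    then have "1 \<in> A n"
      using lr[OF n] l01[OF n] by auto
    then show False
      using atom_subset[OF n] by auto
  qed
  \<comment> \<open>The atom \<open>k\<close> containing \<open>r n\<close> is not \<open>n\<close>,
    whose right end is excluded, nor a later one, since later atoms lie below atom \<open>n\<close>.
    Hence \<open>k \<le> m\<close>, and the ordering gives the bound.\<close>
  have l_le_r: "l m \<le> r n" if n: "n \<ge> 1" and "r n < 1" and "m \<ge> 1" "Suc m = n" for n m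
  proof -
    have "r n > 0"
      using lr[OF n] l01[OF n] by auto
    then obtain k where k: "k \<ge> 1" "r n \<in> A k"
      using \<open>r n < 1\<close> by (blast intro: atom_exists)
    have "k \<noteq> n"
      using k lr[OF n] by auto
    moreover have "\<not> k > n"
      using ord[OF n _ lin[OF n] k(2)] lr[OF n] by auto
    ultimately have "k \<le> m"
      using that by auto
    then show ?thesis
      using ord[OF k(1) _ k(2) lin[OF \<open>m \<ge> 1\<close>]] k lr[OF k(1)] by (cases "k = m") auto
  qed
  have lr_Suc: "l n = r (Suc n)" if n: "n \<ge> 1" for n
  proof -
    have "r (Suc n) \<le> l n"
    proof (rule ccontr)
      assume "\<not> r (Suc n) \<le> l n"
      \<comment> \<open>Both left ends are below \<open>r (Suc n)\<close>, so their maximum is a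
        point of atom \<open>n + 1\<close> that is not below \<open>l n\<close>, against the
        ordering.\<close>
      then have "max (l n) (l (Suc n)) \<in> A (Suc n)"
        using lr[of "Suc n"] by auto
      from ord[OF n _ lin[OF n] this] show False
        by auto
    qed
    with l_le_r[of "Suc n" n] n l01[OF n] show ?thesis
      by auto
  qed
  have one: "r 1 = 1"
  proof (rule ccontr)
    assume "r 1 \<noteq> 1"
    then have "0 < r 1" "r 1 < 1"
      using r1[of 1] lr[of 1] l01[of 1] by auto
    then obtain k where k: "k \<ge> 1" "r 1 \<in> A k"
      by (blast intro: atom_exists)
    then show False
      using ord[of 1 k "l 1" "r 1"] lin[of 1] lr[of 1] by (cases "k = 1") auto
  qed
  \<comment> \<open>All but finitely many atoms lie in \<open>(0,e)\<close>, and each contains its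
    left end.\<close>
  have "l \<longlonglongrightarrow> 0"
  proof (rule LIMSEQ_I)
    fix e :: real assume "e > 0"
    obtain M where M: "\<And>n. n \<ge> 1 \<Longrightarrow> \<not> A n \<subseteq> {0<..<e} \<Longrightarrow> n \<le> M"
      using acc[OF \<open>e > 0\<close>] unfolding finite_nat_set_iff_bounded_le by auto
    have "norm (l n - 0) < e" if "n \<ge> Suc M" for n
      using M[of n] that lin[of n] l01[of n] by force
    then show "\<exists>no. \<forall>n\<ge>no. norm (l n - 0) < e"
      by blast
  qed
  moreover have "\<forall>\<^sub>F n in sequentially. l n = r (Suc n)"
    using lr_Suc by (intro eventually_sequentiallyI[of 1])
  ultimately have "(\<lambda>n. r (Suc n)) \<longlonglongrightarrow> 0"
    by (rule Lim_transform_eventually)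
  then have "r \<longlonglongrightarrow> 0"
    by (simp add: filterlim_sequentially_Suc)
  with one lr lr_Suc show thesis
    by (intro that) auto
qed

text \<open>The endpoints from \<open>atoms_adjacent\<close> are the tails: atom lengths are
  differences of consecutive endpoints, so the series defining \<open>atom_tail\<close>
  telescopes.\<close>

lemma
  shows atom_tail_1: "t 1 = 1"
    and atom_eq: "n \<ge> 1 \<Longrightarrow> A n = {t (Suc n)..<t n}"
    and atom_tail_Suc_less: "n \<ge> 1 \<Longrightarrow> t (Suc n) < t n"
    and atom_length_eq: "n \<ge> 1 \<Longrightarrow> a n = t n - t (Suc n)"
    and atom_tail_LIMSEQ: "t \<longlonglongrightarrow> 0"
proof -
  obtain r where r: "r 1 = 1" "\<And>n. n \<ge> 1 \<Longrightarrow> A n = {r (Suc n)..<r n}"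
    "\<And>n. n \<ge> 1 \<Longrightarrow> r (Suc n) < r n" "r \<longlonglongrightarrow> 0"
    using atoms_adjacent by blast
  have len: "a n = r n - r (Suc n)" if "n \<ge> 1" for n
    using r(2,3)[OF that] by (simp add: atom_length_def)
  have tail: "t n = r n" if "n \<ge> 1" for n
  proof -
    have "(\<lambda>k. r (n + k)) \<longlonglongrightarrow> 0"
      using LIMSEQ_ignore_initial_segment[OF r(4), of n] by (simp add: add.commute)
    from telescope_sums'[OF this] have "(\<lambda>k. a (n + k)) sums r n"
      using that by (simp add: len)
    then show ?thesis
      by (simp add: atom_tail_def sums_iff)
  qed
  show "t 1 = 1" and "n \<ge> 1 \<Longrightarrow> A n = {t (Suc n)..<t n}"
    and "n \<ge> 1 \<Longrightarrow> t (Suc n) < t n" and "n \<ge> 1 \<Longrightarrow> a n = t n - t (Suc n)"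
    using r len by (simp_all add: tail)
  show "t \<longlonglongrightarrow> 0"
    by (rule Lim_transform_eventually[OF r(4)])
       (use tail in \<open>auto intro!: eventually_sequentiallyI[of 1]\<close>)
qed

lemma atom_unique: "\<lbrakk>m \<ge> 1; n \<ge> 1; x \<in> A m; x \<in> A n\<rbrakk> \<Longrightarrow> m = n"
proof -
  assume mn: "m \<ge> 1" "n \<ge> 1" and x: "x \<in> A m" "x \<in> A n"
  have "disjoint_family_on A {1..}"
    using partition unfolding interval_partition_def by blast
  from disjoint_family_onD[OF this, of m n] show "m = n"
    using mn x by auto
qed

lemma atom_index_eq: "\<lbrakk>n \<ge> 1; x \<in> A n\<rbrakk> \<Longrightarrow> atom_index A x = n"
  unfolding atom_index_def using atom_unique by blast

lemma atom_length_pos: "n \<ge> 1 \<Longrightarrow> a n > 0"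
  by (simp add: atom_length_eq atom_tail_Suc_less)

lemma atom_tail_pos: "n \<ge> 1 \<Longrightarrow> t n > 0"
  using atom_subset[of n] atom_eq[of n] atom_tail_Suc_less[of n] by fastforce

lemma first_atom_eq: "first_atom A = {t 2..1}"
  using atom_eq[of 1] atom_tail_1 atom_tail_Suc_less[of 1]
  by (auto simp: first_atom_def numeral_2_eq_2)

lemma atom_length_1: "a 1 = 1 - t 2"
  using atom_length_eq[of 1] atom_tail_1 by (simp add: numeral_2_eq_2)

text \<open>The point \<open>t 2\<close> is the left end of atom \<open>1\<close> and belongs to it,
  so every later atom lies strictly below.\<close>

lemma atom_Suc_less_atom_tail_2: "n \<ge> 1 \<Longrightarrow> y \<in> A (Suc n) \<Longrightarrow> y < t 2"
proof -
  assume "n \<ge> 1" "y \<in> A (Suc n)"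
  moreover have "t 2 \<in> A 1"
    using atom_eq[of 1] atom_tail_Suc_less[of 1] by (simp add: numeral_2_eq_2)
  moreover have "\<forall>m\<ge>1. \<forall>n>m. \<forall>x\<in>A m. \<forall>y\<in>A n. y < x"
    using partition unfolding interval_partition_def by blast
  ultimately show "y < t 2"
    by (metis le_imp_less_Suc order_refl)
qed

section \<open>The Farey map and its inverse branches\<close>

lemma farey_map_atom_Suc:
  assumes "n \<ge> 1" "y \<in> A (Suc n)"
  shows "farey_map A y = a n / a (Suc n) * y + (t (Suc n) - a n / a (Suc n) * t (Suc (Suc n)))"
proof -
  have "0 < y" "y < 1"
    using atom_subset[of "Suc n"] assms by auto
  moreover have "y \<notin> first_atom A"
    using atom_Suc_less_atom_tail_2[OF assms] by (simp add: first_atom_eq)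
  ultimately show ?thesis
    using assms atom_length_pos[of "Suc n"]
    by (simp add: farey_map_def atom_index_eq[of "Suc n"] field_simps)
qed

lemma farey_map_first_atom: "x \<in> first_atom A \<Longrightarrow> farey_map A x = (1 - x) / a 1"
  by (simp add: farey_map_def)

lemma farey_map_atom_Suc_mem:
  assumes "n \<ge> 1" "y \<in> A (Suc n)"
  shows "farey_map A y \<in> A n"
proof -
  have y: "t (Suc (Suc n)) \<le> y" "y < t (Suc n)"
    using assms atom_eq[of "Suc n"] by auto
  have pos: "a n > 0" "a (Suc n) > 0"
    using assms atom_length_pos by auto
  \<comment> \<open>The relative position of \<open>y\<close> in its atom, which the map
    preserves.\<close>
  define s where "s = (y - t (Suc (Suc n))) / a (Suc n)"
  have "0 \<le> s" "s < 1"
    using y pos atom_length_eq[of "Suc n"] by (auto simp: s_def)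
  then have "0 \<le> a n * s" "a n * s < a n"
    using pos by auto
  moreover have "farey_map A y = t (Suc n) + a n * s"
    by (simp add: farey_map_atom_Suc[OF assms] s_def diff_divide_distrib algebra_simps)
  ultimately show ?thesis
    using assms atom_eq[of n] atom_length_eq[of n] by auto
qed

text \<open>The map carries atom \<open>n + 1\<close> into atom \<open>n\<close> with nonzero slope,
  so the index of the image recovers the atom. The remaining points \<open>0\<close> and
  \<open>t 2\<close> go to \<open>0\<close> and \<open>1\<close>, which lie in no atom.\<close>

lemma inj_on_farey_map_branch0: "inj_on (farey_map A) {0..t 2}"
proof (rule inj_onI)
  fix x y assume xy: "x \<in> {0..t 2}" "y \<in> {0..t 2}" and eq: "farey_map A x = farey_map A y"
  have a1: "a 1 > 0"
    using atom_length_pos by simp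
  have F0: "farey_map A 0 = 0"
    using atom_tail_pos[of 2] by (simp add: farey_map_def first_atom_eq)
  have Ft2: "farey_map A (t 2) = 1"
    using a1 atom_length_1 by (simp add: farey_map_first_atom first_atom_eq)
  have cases: "z = 0 \<or> z = t 2 \<or> (\<exists>n\<ge>1. z \<in> A (Suc n))" if "z \<in> {0..t 2}" for z
  proof (cases "z = 0 \<or> z = t 2")
    case False
    with that a1 atom_length_1 have z: "0 < z" "z < t 2" "z < 1"
      by auto
    obtain n where n: "n \<ge> 1" "z \<in> A n"
      using atom_exists z by blast
    have "n \<noteq> 1"
      using n z atom_eq[of 1] by (auto simp: numeral_2_eq_2)
    with n show ?thesis
      by (cases n) auto
  qed auto
  have F01: "farey_map A z \<noteq> 0" "farey_map A z \<noteq> 1" if "n \<ge> 1" "z \<in> A (Suc n)" for z n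
    using farey_map_atom_Suc_mem[OF that] atom_subset[OF that(1)] by auto
  have "x = y" if x: "n \<ge> 1" "x \<in> A (Suc n)" and y: "m \<ge> 1" "y \<in> A (Suc m)" for n m
  proof -
    have "n = m"
      using atom_unique[OF x(1) y(1)] farey_map_atom_Suc_mem[OF x] farey_map_atom_Suc_mem[OF y] eq
      by simp
    then show ?thesis
      using eq atom_length_pos[of n] atom_length_pos[of "Suc n"] x y
      by (auto simp: farey_map_atom_Suc)
  qed
  then show "x = y"
    using cases[OF xy(1)] cases[OF xy(2)] eq F0 Ft2 F01 by force
qed

lemma farey_branch0_farey_map:
  assumes "n \<ge> 1" "y \<in> A (Suc n)"
  shows "farey_branch0 A (farey_map A y) = y"
  unfolding farey_branch0_def
  using atom_Suc_less_atom_tail_2[OF assms] atom_subset[of "Suc n"] assms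
  by (intro the_inv_into_f_f inj_on_farey_map_branch0) auto

lemma farey_branch1_eq:
  assumes "x \<in> {0..1}"
  shows "farey_branch1 A x = 1 - a 1 * x"
  unfolding farey_branch1_def
proof (rule the_inv_into_f_eq)
  have a1: "a 1 > 0"
    using atom_length_pos by simp
  then show "inj_on (farey_map A) {t 2..1}"
    by (auto intro!: inj_onI simp: farey_map_first_atom first_atom_eq)
  have "0 \<le> a 1 * x" "a 1 * x \<le> a 1"
    using assms a1 by (simp_all add: mult_left_le)
  then show mem: "1 - a 1 * x \<in> {t 2..1}"
    using atom_length_1 by auto
  then show "farey_map A (1 - a 1 * x) = x"
    using a1 by (simp add: farey_map_first_atom first_atom_eq)
qed

section \<open>The transfer operator and the propagation of convergence\<close>

lemma farey_transfer_farey_map: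
  assumes "n \<ge> 1" "y \<in> A (Suc n)"
  shows "farey_transfer A v (farey_map A y) =
    t (Suc n) / t n * v y + (1 - t (Suc n) / t n) * v (1 - a 1 * farey_map A y)"
proof -
  have mem: "farey_map A y \<in> A n"
    by (rule farey_map_atom_Suc_mem[OF assms])
  then have "farey_map A y \<in> {0<..<1}"
    using atom_subset assms by blast
  then show ?thesis
    using assms mem
    by (simp add: farey_transfer_def atom_index_eq farey_branch0_farey_map farey_branch1_eq)
qed

text \<open>The identity \<open>farey_transfer_farey_map\<close> is solved for \<open>v y\<close>,
  with the iterate in place of \<open>v\<close>. Only the two points derived from \<open>y\<close>
  have to lie in \<open>S\<close>, so \<open>T\<close> and \<open>S\<close> may have exceptional
  sets removed.\<close>

lemma uniform_limit_pull_back: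
  fixes w :: "nat \<Rightarrow> real"
  assumes ratio: "(\<lambda>m. w m / w (Suc m)) \<longlonglongrightarrow> 1" and n: "n \<ge> 1"
    and T: "T \<subseteq> A (Suc n)" "farey_map A ` T \<subseteq> S" "(\<lambda>y. 1 - a 1 * farey_map A y) ` T \<subseteq> S"
    and lim: "uniform_limit S (\<lambda>m x. w m * (farey_transfer A ^^ m) v x) (\<lambda>_. c) sequentially"
  shows "uniform_limit T (\<lambda>m x. w m * (farey_transfer A ^^ m) v x) (\<lambda>_. c) sequentially"
proof -
  let ?f = "\<lambda>m x. w m * (farey_transfer A ^^ m) v x"
  let ?F = "farey_map A"
  define p where "p = t (Suc n) / t n"
  have "p \<noteq> 0"
    using n atom_tail_pos[of n] atom_tail_pos[of "Suc n"] by (simp add: p_def)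
  have "uniform_limit T (\<lambda>m y. ?f (Suc m) (?F y)) (\<lambda>_. c) sequentially"
    using T(2) uniform_limit_compose'[OF filterlim_compose[OF lim filterlim_Suc], of ?F T] by auto
  from uniform_limit_mult_LIMSEQ[OF ratio this]
  have image: "uniform_limit T (\<lambda>m y. w m / w (Suc m) * ?f (Suc m) (?F y)) (\<lambda>_. 1 * c) sequentially" .
  have "uniform_limit T (\<lambda>m y. ?f m (1 - a 1 * ?F y)) (\<lambda>_. c) sequentially"
    using T(3) uniform_limit_compose'[OF lim, of "\<lambda>y. 1 - a 1 * ?F y" T] by auto
  from uniform_limit_mult_LIMSEQ[OF tendsto_const this, of "1 - p"]
  have preimage: "uniform_limit T (\<lambda>m y. (1 - p) * ?f m (1 - a 1 * ?F y)) (\<lambda>_. (1 - p) * c) sequentially" .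
  have limit: "uniform_limit T
      (\<lambda>m y. (1 / p) * (w m / w (Suc m) * ?f (Suc m) (?F y) - (1 - p) * ?f m (1 - a 1 * ?F y)))
      (\<lambda>_. (1 / p) * (1 * c - (1 - p) * c)) sequentially"
    by (rule uniform_limit_mult_LIMSEQ[OF tendsto_const uniform_limit_minus[OF image preimage]])
  \<comment> \<open>Division by zero yields \<open>0\<close>, so a nonzero ratio also ensures
    \<open>w (Suc m) \<noteq> 0\<close>, which allows cancelling this factor below.\<close>
  have "\<forall>\<^sub>F m in sequentially. w m / w (Suc m) \<noteq> 0"
    by (rule tendsto_imp_eventually_ne[OF ratio]) simp
  then have "\<forall>\<^sub>F m in sequentially. \<forall>y\<in>T.
      (1 / p) * (w m / w (Suc m) * ?f (Suc m) (?F y) - (1 - p) * ?f m (1 - a 1 * ?F y)) = ?f m y"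
  proof (eventually_elim, intro ballI)
    fix m y assume "w m / w (Suc m) \<noteq> 0" "y \<in> T"
    then have "w m / w (Suc m) * ?f (Suc m) (?F y) = w m * farey_transfer A ((farey_transfer A ^^ m) v) (?F y)"
      by simp
    also have "\<dots> = p * ?f m y + (1 - p) * ?f m (1 - a 1 * ?F y)"
      using T(1) \<open>y \<in> T\<close> n by (subst farey_transfer_farey_map[of n]) (auto simp: p_def algebra_simps)
    finally show "(1 / p) * (w m / w (Suc m) * ?f (Suc m) (?F y) - (1 - p) * ?f m (1 - a 1 * ?F y)) = ?f m y"
      using \<open>p \<noteq> 0\<close> by simp
  qed
  moreover have "(1 / p) * (1 * c - (1 - p) * c) = c"
    using \<open>p \<noteq> 0\<close> by (simp add: field_simps)
  ultimately have "uniform_limit T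
      (\<lambda>m y. (1 / p) * (w m / w (Suc m) * ?f (Suc m) (?F y) - (1 - p) * ?f m (1 - a 1 * ?F y)))
      (\<lambda>_. (1 / p) * (1 * c - (1 - p) * c)) sequentially \<longleftrightarrow> ?thesis"
    by (rule uniform_limit_cong)
  with limit show ?thesis
    by blast
qed

text \<open>
  The predicate \<open>small\<close> is instantiated by the empty set for uniform convergence and by the null
  sets for almost everywhere uniform convergence.
\<close>

lemma uniform_limit_compact_modulo:
  fixes w :: "nat \<Rightarrow> real" and small :: "real set \<Rightarrow> bool"
  assumes Un: "\<And>M N. small M \<Longrightarrow> small N \<Longrightarrow> small (M \<union> N)"
    and vimage: "\<And>N c d. small N \<Longrightarrow> c \<noteq> 0 \<Longrightarrow> small ((\<lambda>x. c * x + d) -` N)"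
    and ratio: "(\<lambda>m. w m / w (Suc m)) \<longlonglongrightarrow> 1"
    and "small N"
    and lim: "uniform_limit (first_atom A - N)
      (\<lambda>m x. w m * (farey_transfer A ^^ m) v x) (\<lambda>_. c) sequentially"
    and K: "compact K" "K \<subseteq> {0<..1}"
  obtains N' where "small N'"
    and "uniform_limit (K - N') (\<lambda>m x. w m * (farey_transfer A ^^ m) v x) (\<lambda>_. c) sequentially"
proof -
  let ?f = "\<lambda>m x. w m * (farey_transfer A ^^ m) v x"
  \<comment> \<open>Induction on the number of atoms covered. For \<open>n = 1\<close> the interval
    is the closed first atom; each step adds the atom adjacent on the left.\<close>
  have ex: "\<exists>M. small M \<and> uniform_limit ({t (Suc n)..1} - M) ?f (\<lambda>_. c) sequentially"
    if "n \<ge> 1" for n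
    using that
  proof (induction n rule: nat_induct_at_least)
    case base
    then show ?case
      using \<open>small N\<close> lim by (auto simp: first_atom_eq numeral_2_eq_2)
  next
    case (Suc n)
    then obtain M where M: "small M" and limM: "uniform_limit ({t (Suc n)..1} - M) ?f (\<lambda>_. c) sequentially"
      by auto
    define k d where "k = a n / a (Suc n)" and "d = t (Suc n) - k * t (Suc (Suc n))"
    have F: "farey_map A y = k * y + d" if "y \<in> A (Suc n)" for y
      using farey_map_atom_Suc[OF Suc.hyps that] by (simp add: k_def d_def)
    have "a 1 > 0" "k > 0"
      using atom_length_pos Suc.hyps by (auto simp: k_def)
    \<comment> \<open>On atom \<open>n + 1\<close> both \<open>farey_map A\<close> and the passage
      to the other preimage are affine, with slopes \<open>k\<close> and \<open>- a 1 * k\<close>.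
      Removing these two preimages of \<open>M\<close> keeps both derived points outside
      \<open>M\<close>.\<close>
    define M' where
      "M' = M \<union> (\<lambda>x. k * x + d) -` M \<union> (\<lambda>x. (- a 1 * k) * x + (1 - a 1 * d)) -` M"
    have "small M'"
      unfolding M'_def using M \<open>a 1 > 0\<close> \<open>k > 0\<close> by (intro Un vimage) auto
    have tail: "t (Suc n) \<le> t 2"
      using Suc.hyps
    proof (induction n rule: nat_induct_at_least)
      case (Suc n)
      then show ?case
        using atom_tail_Suc_less[of "Suc n"] by simp
    qed (simp add: numeral_2_eq_2)
    have "uniform_limit (A (Suc n) - M') ?f (\<lambda>_. c) sequentially"
    proof (rule uniform_limit_pull_back[OF ratio Suc.hyps _ _ _ limM])
      have F_mem: "farey_map A y \<in> A n" if "y \<in> A (Suc n)" for y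
        by (rule farey_map_atom_Suc_mem[OF Suc.hyps that])
      have "A n \<subseteq> {t (Suc n)..1}"
        using atom_eq[OF Suc.hyps] atom_subset[OF Suc.hyps] by auto
      then show "farey_map A ` (A (Suc n) - M') \<subseteq> {t (Suc n)..1} - M"
        using F_mem by (auto simp: M'_def F)
      \<comment> \<open>The other preimage lies in the closed first atom \<open>[t 2, 1]\<close>,
        which \<open>tail\<close> places inside the interval already treated.\<close>
      have "1 - a 1 * farey_map A y \<in> {t (Suc n)..1}" if "y \<in> A (Suc n)" for y
      proof -
        have "0 < farey_map A y" "farey_map A y < 1"
          using F_mem[OF that] atom_subset[OF Suc.hyps] by auto
        then have "0 \<le> a 1 * farey_map A y" "a 1 * farey_map A y \<le> a 1"
          using \<open>a 1 > 0\<close> by (simp_all add: mult_left_le)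
        then show ?thesis
          using atom_length_1 tail by auto
      qed
      then show "(\<lambda>y. 1 - a 1 * farey_map A y) ` (A (Suc n) - M') \<subseteq> {t (Suc n)..1} - M"
        by (auto simp: M'_def F algebra_simps)
    qed auto
    moreover have "uniform_limit ({t (Suc n)..1} - M') ?f (\<lambda>_. c) sequentially"
      by (rule uniform_limit_on_subset[OF limM]) (auto simp: M'_def)
    ultimately have "uniform_limit ((A (Suc n) - M') \<union> ({t (Suc n)..1} - M')) ?f (\<lambda>_. c) sequentially"
      by (rule uniform_limit_on_Un)
    moreover have "{t (Suc (Suc n))..1} - M' \<subseteq> (A (Suc n) - M') \<union> ({t (Suc n)..1} - M')"
    proof
      fix x assume x: "x \<in> {t (Suc (Suc n))..1} - M'"
      show "x \<in> (A (Suc n) - M') \<union> ({t (Suc n)..1} - M')"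
      proof (cases "x < t (Suc n)")
        case True
        then have "x \<in> A (Suc n)"
          using x by (subst atom_eq) simp_all
        then show ?thesis
          using x by blast
      next
        case False
        then have "x \<in> {t (Suc n)..1}"
          using x by simp
        then show ?thesis
          using x by blast
      qed
    qed
    ultimately have "uniform_limit ({t (Suc (Suc n))..1} - M') ?f (\<lambda>_. c) sequentially"
      by (rule uniform_limit_on_subset)
    with \<open>small M'\<close> show ?case
      by (intro exI[of _ M'] conjI)
  qed
  \<comment> \<open>A nonempty compact \<open>K\<close> has a least element \<open>e > 0\<close>,
    and the tails tend to \<open>0\<close>.\<close>
  have "\<exists>n\<ge>1. K \<subseteq> {t (Suc n)..1}"
  proof (cases "K = {}")
    case False
    then obtain e where e: "e \<in> K" "\<And>x. x \<in> K \<Longrightarrow> e \<le> x"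
      using compact_attains_inf[OF K(1) False] by auto
    then have "\<forall>\<^sub>F n in sequentially. t (Suc n) < e"
      using K(2) order_tendstoD(2)[OF LIMSEQ_Suc[OF atom_tail_LIMSEQ]] by auto
    then obtain M where "\<And>n. n \<ge> M \<Longrightarrow> t (Suc n) < e"
      by (auto simp: eventually_sequentially)
    \<comment> \<open>The index \<open>Suc M\<close> replaces \<open>M\<close> to guarantee
      \<open>n \<ge> 1\<close>.\<close>
    then have "t (Suc (Suc M)) < e"
      by auto
    then have "K \<subseteq> {t (Suc (Suc M))..1}"
      using e K(2) by force
    then show ?thesis
      by force
  qed auto
  then obtain n where "n \<ge> 1" and Kn: "K \<subseteq> {t (Suc n)..1}"
    by auto
  from ex[OF \<open>n \<ge> 1\<close>] obtain M
    where "small M" "uniform_limit ({t (Suc n)..1} - M) ?f (\<lambda>_. c) sequentially"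
    by auto
  moreover have "K - M \<subseteq> {t (Suc n)..1} - M"
    using Kn by blast
  ultimately show thesis
    using that uniform_limit_on_subset by blast
qed

end

theorem theorem1p1:
  fixes A :: "nat \<Rightarrow> real set" and \<delta> :: real and v :: "real \<Rightarrow> real"
  assumes "interval_partition A"
    and "\<not> summable (\<lambda>n. atom_tail A (Suc n))"
    and "(\<lambda>n. wandering_rate A n / wandering_rate A (Suc n)) \<longlonglongrightarrow> 1"
    and "0 < \<delta>" and "\<delta> \<le> 1"
    and "integrable (farey_measure A) v"
  shows
    "(uniform_limit (first_atom A)
        (\<lambda>n x. wandering_rate A n * (farey_transfer A ^^ n) v x)
        (\<lambda>x. Gamma_const \<delta> * (\<integral>y. v y \<partial>farey_measure A)) sequentially \<longrightarrow>
      (\<forall>K. compact K \<and> K \<subseteq> {0<..1} \<longrightarrow>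
        uniform_limit K
          (\<lambda>n x. wandering_rate A n * (farey_transfer A ^^ n) v x)
          (\<lambda>x. Gamma_const \<delta> * (\<integral>y. v y \<partial>farey_measure A)) sequentially)) \<and>
     (ae_uniform_limit (first_atom A)
        (\<lambda>n x. wandering_rate A n * (farey_transfer A ^^ n) v x)
        (\<lambda>x. Gamma_const \<delta> * (\<integral>y. v y \<partial>farey_measure A)) \<longrightarrow>
      (\<forall>K. compact K \<and> K \<subseteq> {0<..1} \<longrightarrow>
        ae_uniform_limit K
          (\<lambda>n x. wandering_rate A n * (farey_transfer A ^^ n) v x)
          (\<lambda>x. Gamma_const \<delta> * (\<integral>y. v y \<partial>farey_measure A))))"
proof (intro conjI impI allI; elim conjE)
  interpret farey_partition A
    by (unfold_locales) fact
  fix K :: "real set"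
  assume K: "compact K" "K \<subseteq> {0<..1}"
  let ?f = "\<lambda>n x. wandering_rate A n * (farey_transfer A ^^ n) v x"
  let ?l = "\<lambda>x::real. Gamma_const \<delta> * (\<integral>y. v y \<partial>farey_measure A)"
  {
    assume "uniform_limit (first_atom A) ?f ?l sequentially"
    then have lim: "uniform_limit (first_atom A - {}) ?f ?l sequentially"
      by simp
    show "uniform_limit K ?f ?l sequentially"
      using uniform_limit_compact_modulo[where small = "\<lambda>N. N = {}", OF _ _ assms(3) refl lim K]
      by (metis Diff_empty Un_empty vimage_empty)
  next
    assume "ae_uniform_limit (first_atom A) ?f ?l"
    then obtain N where N: "N \<in> null_sets lebesgue"
      and lim: "uniform_limit (first_atom A - N) ?f ?l sequentially"
      by (auto simp: ae_uniform_limit_def)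
    obtain N' where "N' \<in> null_sets lebesgue" "uniform_limit (K - N') ?f ?l sequentially"
      by (rule uniform_limit_compact_modulo[where small = "\<lambda>N. N \<in> null_sets lebesgue",
            OF null_sets.Un null_sets_affine_vimage assms(3) N lim K])
    then show "ae_uniform_limit K ?f ?l"
      by (auto simp: ae_uniform_limit_def)
  }
qed

end
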